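(* Let $F_1, F_2 \colon \mathbb{R}^n \rightrightarrows \mathbb{R}^m$ be set-valued mappings with closed graphs, let $F := F_1 + F_2$, and let $\overline{y} \in J(F)$. Assume that both of the following conditions are satisfied. (a) (boundedness condition) There exist constants $R > 0$, $\rho > 0$ and a neighborhood $V$ of $\overline{y}$ such that whenever $\|x\| > R$, $y_i \in F_i(x)$ ($i=1,2$) and $y_1 + y_2 \in V$, one has $\|y_i\| < \rho$ for $i = 1, 2$. (b) (constraint qualification) For every $(y_1,y_2)\in J^+(F_1+F_2,\overline{y})$ we have $$D^*F_1(\infty , y_1) (0)\cap \big(-D^*F_2(\infty , y_2)(0) \big) = \{0\}.$$ Then $\mathrm{gph}\, F$ is locally closed at $(\infty, \overline{y})$, and for all $v \in \mathbb{R}^m$ we have $$D^*F (\infty, \overline{y})(v) \subset \bigcup_{(\overline{y}_1,\overline{y}_2) \in J^+(F_1+F_2,\overline{y})} \Big( D^*F_1(\infty , \overline{y}_1) (v)+ D^*F_2(\infty , \overline{y}_2)(v)\Big).$$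
   Context: All spaces $\mathbb{R}^n$ carry the Euclidean norm. For $F\colon \mathbb{R}^n \rightrightarrows \mathbb{R}^m$, $\mathrm{gph}\,F := \{(x,y) : y\in F(x)\}$. The sum is $(F_1+F_2)(x) := \{y_1+y_2 : y_1\in F_1(x),\ y_2\in F_2(x)\}$. Jelonek set: $J(F)$ is the set of $y\in\mathbb{R}^m$ for which there exist $(x_k,y_k)\in \mathrm{gph}\,F$ with $\|x_k\|\to\infty$ and $y_k\to y$. For $y\in\mathbb{R}^m$, $J^+(F_1+F_2,y)$ is the set of all $(y_1,y_2)\in\mathbb{R}^m\times\mathbb{R}^m$ with $y_1+y_2=y$ for which there exist $x_k$ with $\|x_k\|\to\infty$, $y_{1,k}\in F_1(x_k)$ and $y_{2,k}\in F_2(x_k)$ with $(y_{1,k},y_{2,k})\to(y_1,y_2)$. Local closedness at infinity: a set $\Omega\subset\mathbb{R}^n\times\mathbb{R}^m$ is locally closed at $(\infty,\overline{y})$ if there are $R>0$ and a closed neighborhood $V$ of $\overline{y}$ such that $\{(x,y)\in\Omega : \|x\|\ge R,\ y\in V\}$ is closed. Regular normal cone: for a set $\Omega\subset\mathbb{R}^N$ and $z\in\Omega$, $\widehat{N}_\Omega(z)$ is the set of $\xi\in\mathbb{R}^N$ with $\langle \xi, z'-z\rangle\le o(\|z'-z\|)$ as $z'\to z$, $z'\in\Omega$. Normal cone at infinity: for $\Omega\subset\mathbb{R}^n\times\mathbb{R}^m$ and $\overline{y}\in\mathbb{R}^m$, $N_\Omega(\infty,\overline{y})$ is the set of all $\xi$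 for which there exist $(x_k,y_k)\in\Omega$ with $\|x_k\|\to\infty$, $y_k\to\overline{y}$, and $\xi_k\in\widehat{N}_\Omega(x_k,y_k)$ with $\xi_k\to\xi$. Coderivative at infinity: for $\overline{y}\in J(F)$, $D^*F(\infty,\overline{y})(v) := \{u\in\mathbb{R}^n : (u,-v)\in N_{\mathrm{gph}\,F}(\infty,\overline{y})\}$, $v\in\mathbb{R}^m$. *)

theory Defs
  imports "HOL-Analysis.Analysis"
begin

text \<open>
  A set-valued mapping \<open>F : X \<rightrightarrows> Y\<close> is a function of type \<open>'a \<Rightarrow> 'b set\<close>.
  Product spaces carry the norm and inner product of the library's product instance, so
  \<open>(real ^ 'n) \<times> (real ^ 'm)\<close> is the Euclidean space of dimension \<open>n + m\<close>.
  Sums of sets are the Minkowski sums of \<open>HOL-Library.Set_Algebras\<close>.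
  A neighbourhood of \<open>y\<close> is a set \<open>V\<close>, not necessarily open, with \<open>y \<in> interior V\<close>.
\<close>

definition gph :: "('a \<Rightarrow> 'b set) \<Rightarrow> ('a \<times> 'b) set" where
  "gph F = {(x, y). y \<in> F x}"

definition jelonek_set ::
  "('a::real_normed_vector \<Rightarrow> 'b::real_normed_vector set) \<Rightarrow> 'b set" where
  "jelonek_set F = {y. \<exists>x y'. (\<forall>k::nat. (x k, y' k) \<in> gph F) \<and>
     filterlim (\<lambda>k. norm (x k)) at_top sequentially \<and> y' \<longlonglongrightarrow> y}"

text \<open>\<open>J\<^sup>+(F1 + F2, y)\<close> depends on the two summands and not only on their sum.\<close>

definition jelonek_plus ::
  "('a::real_normed_vector \<Rightarrow> 'b::real_normed_vector set) \<Rightarrow> ('a \<Rightarrow> 'b set) \<Rightarrow> 'b \<Rightarrow> ('b \<times> 'b) set"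
  where
  "jelonek_plus F1 F2 y = {(y1, y2). y1 + y2 = y \<and>
     (\<exists>x y1' y2'. filterlim (\<lambda>k::nat. norm (x k)) at_top sequentially \<and>
        (\<forall>k. y1' k \<in> F1 (x k) \<and> y2' k \<in> F2 (x k)) \<and>
        (\<lambda>k. (y1' k, y2' k)) \<longlonglongrightarrow> (y1, y2))}"

definition locally_closed_at_infinity ::
  "('a::real_normed_vector \<times> 'b::real_normed_vector) set \<Rightarrow> 'b \<Rightarrow> bool" where
  "locally_closed_at_infinity \<Omega> y \<longleftrightarrow>
     (\<exists>R>0. \<exists>V. closed V \<and> y \<in> interior V \<and>
        closed {(x, y'). (x, y') \<in> \<Omega> \<and> norm x \<ge> R \<and> y' \<in> V})"

text \<open>
  The one-sided estimate \<open>\<langle>\<xi>, z' - z\<rangle> \<le> o(\<parallel>z' - z\<parallel>)\<close> is spelled out with \<open>\<epsilon>\<close>. The notion is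
  meant for \<open>z \<in> \<Omega>\<close> only.
\<close>

definition regular_normal_cone :: "'a::real_inner set \<Rightarrow> 'a \<Rightarrow> 'a set" where
  "regular_normal_cone \<Omega> z =
     {\<xi>. \<forall>\<epsilon>>0. \<forall>\<^sub>F z' in at z within \<Omega>. \<xi> \<bullet> (z' - z) \<le> \<epsilon> * norm (z' - z)}"

definition normal_cone_at_infinity ::
  "('a::real_inner \<times> 'b::real_inner) set \<Rightarrow> 'b \<Rightarrow> ('a \<times> 'b) set" where
  "normal_cone_at_infinity \<Omega> y = {\<xi>. \<exists>x y' \<xi>'.
     (\<forall>k::nat. (x k, y' k) \<in> \<Omega> \<and> \<xi>' k \<in> regular_normal_cone \<Omega> (x k, y' k)) \<and>
     filterlim (\<lambda>k. norm (x k)) at_top sequentially \<and> y' \<longlonglongrightarrow> y \<and> \<xi>' \<longlonglongrightarrow> \<xi>}"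

text \<open>
  Intended for \<open>y \<in> jelonek_set F\<close>; for other \<open>y\<close> the normal cone at infinity, and hence the
  coderivative, is empty.
\<close>

definition coderivative_at_infinity ::
  "('a::real_inner \<Rightarrow> 'b::real_inner set) \<Rightarrow> 'b \<Rightarrow> 'b \<Rightarrow> 'a set" where
  "coderivative_at_infinity F y v = {u. (u, - v) \<in> normal_cone_at_infinity (gph F) y}"

end

theory Submission
  imports Defs
begin

text \<open>
  A coderivative of \<open>F1 + F2\<close> at infinity is a limit of regular normals \<open>(u k, - v k)\<close> to the graph of
  the sum, taken at points \<open>(x k, a k + b k)\<close> with \<open>x k\<close> running to infinity. The boundedness condition
  makes the summands \<open>a k\<close> and \<open>b k\<close> cluster, at a pair in \<open>J\<^sup>+\<close>; the same compactness argument gives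
  closedness of the graph near \<open>(\<infinity>, y)\<close>.

  Such a normal has to be split between the two graphs. Lifting it to the triples \<open>(x, a, b)\<close> gives
  a regular normal \<open>(u, - v, - v)\<close> to the intersection of two cylinders, one over each graph
  (\<open>regular_normal_cone_pullback\<close>). At a point of an intersection of closed sets, every regular
  normal is up to \<open>\<epsilon>\<close> a sum of regular normals to each set at nearby points
  (\<open>fuzzy_intersection_rule\<close>): constrain two independent points \<open>p\<close> and \<open>q\<close> to the two sets and
  minimise with a large multiple of \<open>\<parallel>p - q\<parallel>\<^sup>2\<close> as penalty; the gradient of the objective at the
  minimiser is the splitting. The sizes of the two pieces are
  left uncontrolled. The outcome is
  \<open>regular_normal_cone_gph_sum\<close>: \<open>u k \<approx> u1 k + u2 k\<close> and \<open>v k \<approx> v1 k \<approx> v2 k\<close>.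

  The constraint qualification supplies the missing bound. With \<open>s k = 1 / (1 + \<parallel>u1 k\<parallel>)\<close> both \<open>s k\<close>
  and \<open>s k u1 k\<close> are bounded, and they have a common cluster point \<open>(\<sigma>, w)\<close> with \<open>\<sigma> + \<parallel>w\<parallel> = 1\<close>.
  Scaling the two normals by \<open>s k\<close> and passing to the limit gives
  \<open>(w, - \<sigma> v)\<close> and \<open>(\<sigma> u - w, - \<sigma> v)\<close> in the normal cones at infinity of the two graphs. If \<open>\<sigma>\<close> were \<open>0\<close>,
  the unit vector \<open>w\<close> would violate the qualification; for \<open>\<sigma> > 0\<close> division by \<open>\<sigma>\<close> yields the
  decomposition \<open>u = w / \<sigma> + (u - w / \<sigma>)\<close>.
\<close>

section \<open>Calculus of regular normals\<close>

text \<open>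
  The point \<open>z\<close> itself, which the filter \<open>at z within \<Omega>\<close> leaves out, satisfies the estimate trivially.
\<close>

lemma regular_normal_cone_iff:
  "\<xi> \<in> regular_normal_cone \<Omega> z \<longleftrightarrow>
     (\<forall>\<epsilon>>0. \<exists>\<delta>>0. \<forall>w\<in>\<Omega>. norm (w - z) < \<delta> \<longrightarrow> \<xi> \<bullet> (w - z) \<le> \<epsilon> * norm (w - z))"
proof -
  have "(\<forall>\<^sub>F w in at z within \<Omega>. \<xi> \<bullet> (w - z) \<le> \<epsilon> * norm (w - z)) \<longleftrightarrow>
     (\<exists>\<delta>>0. \<forall>w\<in>\<Omega>. norm (w - z) < \<delta> \<longrightarrow> \<xi> \<bullet> (w - z) \<le> \<epsilon> * norm (w - z))" for \<epsilon>
    unfolding eventually_at dist_norm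
    by (intro ex_cong conj_cong refl ball_cong) (metis diff_self inner_zero_right mult_zero_right norm_zero order_refl)
  then show ?thesis
    by (simp add: regular_normal_cone_def)
qed

lemma regular_normal_cone_scaleR:
  assumes "\<xi> \<in> regular_normal_cone \<Omega> z" "c > 0"
  shows "c *\<^sub>R \<xi> \<in> regular_normal_cone \<Omega> z"
  unfolding regular_normal_cone_iff
proof (intro allI impI)
  fix \<epsilon> :: real assume "\<epsilon> > 0"
  then have "\<epsilon> / c > 0" using assms by simp
  then obtain \<delta> where "\<delta> > 0" and
    d: "\<And>w. w \<in> \<Omega> \<Longrightarrow> norm (w - z) < \<delta> \<Longrightarrow> \<xi> \<bullet> (w - z) \<le> \<epsilon> / c * norm (w - z)"
    using assms(1) unfolding regular_normal_cone_iff by meson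
  have "c *\<^sub>R \<xi> \<bullet> (w - z) \<le> \<epsilon> * norm (w - z)" if "w \<in> \<Omega>" "norm (w - z) < \<delta>" for w
    using d[OF that] assms(2) by (simp add: field_simps)
  with \<open>\<delta> > 0\<close> show "\<exists>\<delta>>0. \<forall>w\<in>\<Omega>. norm (w - z) < \<delta> \<longrightarrow> c *\<^sub>R \<xi> \<bullet> (w - z) \<le> \<epsilon> * norm (w - z)"
    by blast
qed

text \<open>
  An affine map of \<open>\<Omega>'\<close> into \<open>\<Omega>\<close> is Lipschitz, so that the adjoint of its linear part carries normals to
  \<open>\<Omega>\<close> back to normals to \<open>\<Omega>'\<close>. Addition of the two value components, the embeddings of a graph into a
  cylinder over it, and the embedding of a fibre are all maps of this kind.
\<close>

lemma regular_normal_cone_pullback: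
  fixes h :: "'a::real_inner \<Rightarrow> 'b::real_inner"
  assumes normal: "\<xi> \<in> regular_normal_cone \<Omega> (h p)"
    and maps: "\<And>w. w \<in> \<Omega>' \<Longrightarrow> h w \<in> \<Omega>"
    and L: "bounded_linear L" "\<And>w. h w - h p = L (w - p)"
    and adjoint: "\<And>d. \<xi> \<bullet> L d = \<eta> \<bullet> d"
  shows "\<eta> \<in> regular_normal_cone \<Omega>' p"
  unfolding regular_normal_cone_iff
proof (intro allI impI)
  fix \<epsilon> :: real assume "\<epsilon> > 0"
  obtain C where C: "C > 0" "\<And>d. norm (L d) \<le> norm d * C"
    using bounded_linear.pos_bounded[OF L(1)] by blast
  then have "\<epsilon> / C > 0" using \<open>\<epsilon> > 0\<close> by simp
  then obtain \<delta> where "\<delta> > 0" and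
    d: "\<And>w. w \<in> \<Omega> \<Longrightarrow> norm (w - h p) < \<delta> \<Longrightarrow> \<xi> \<bullet> (w - h p) \<le> \<epsilon> / C * norm (w - h p)"
    using normal unfolding regular_normal_cone_iff by meson
  have "\<eta> \<bullet> (w - p) \<le> \<epsilon> * norm (w - p)" if w: "w \<in> \<Omega>'" "norm (w - p) < \<delta> / C" for w
  proof -
    have "norm (h w - h p) < \<delta>"
      using C(2)[of "w - p"] w(2) C(1) by (simp add: L(2) field_simps)
    then have "\<eta> \<bullet> (w - p) \<le> \<epsilon> / C * norm (L (w - p))"
      using d[OF maps[OF w(1)]] by (simp add: L(2) adjoint)
    also have "\<dots> \<le> \<epsilon> / C * (norm (w - p) * C)"
      using C \<open>\<epsilon> > 0\<close> by (intro mult_left_mono) auto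
    finally show ?thesis using C(1) by simp
  qed
  moreover have "\<delta> / C > 0" using \<open>\<delta> > 0\<close> C(1) by simp
  ultimately show "\<exists>\<delta>>0. \<forall>w\<in>\<Omega>'. norm (w - p) < \<delta> \<longrightarrow> \<eta> \<bullet> (w - p) \<le> \<epsilon> * norm (w - p)"
    by blast
qed

lemma regular_normal_cone_UNIV:
  fixes \<xi> :: "'a::real_inner"
  assumes "\<xi> \<in> regular_normal_cone UNIV z"
  shows "\<xi> = 0"
proof (rule ccontr)
  assume "\<xi> \<noteq> 0"
  then have "norm \<xi> / 2 > 0" by simp
  then obtain \<delta> where "\<delta> > 0" and
    d: "\<And>w. norm (w - z) < \<delta> \<Longrightarrow> \<xi> \<bullet> (w - z) \<le> norm \<xi> / 2 * norm (w - z)"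
    using assms unfolding regular_normal_cone_iff by (metis UNIV_I)
  define t where "t = \<delta> / (2 * norm \<xi>)"
  have t: "t > 0" "t * norm \<xi> < \<delta>"
    using \<open>\<delta> > 0\<close> \<open>\<xi> \<noteq> 0\<close> by (auto simp: t_def)
  have "t * (norm \<xi>)\<^sup>2 \<le> t * (norm \<xi>)\<^sup>2 / 2"
    using d[of "z + t *\<^sub>R \<xi>"] t by (simp add: power2_norm_eq_inner[symmetric] power2_eq_square)
  then show False using t(1) \<open>\<xi> \<noteq> 0\<close> by simp
qed

lemma regular_normal_cone_local_min:
  fixes f :: "'a::real_inner \<Rightarrow> real"
  assumes deriv: "(f has_derivative (\<lambda>d. - (\<xi> \<bullet> d))) (at p)"
    and "r > 0" and min: "\<And>w. w \<in> \<Omega> \<Longrightarrow> norm (w - p) < r \<Longrightarrow> f p \<le> f w"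
  shows "\<xi> \<in> regular_normal_cone \<Omega> p"
  unfolding regular_normal_cone_iff
proof (intro allI impI)
  fix \<epsilon> :: real assume "\<epsilon> > 0"
  then obtain \<delta> where "\<delta> > 0" and
    d: "\<And>w. norm (w - p) < \<delta> \<Longrightarrow> norm (f w - f p - - (\<xi> \<bullet> (w - p))) \<le> \<epsilon> * norm (w - p)"
    using deriv unfolding has_derivative_at_alt by meson
  have "\<xi> \<bullet> (w - p) \<le> \<epsilon> * norm (w - p)" if "w \<in> \<Omega>" "norm (w - p) < min \<delta> r" for w
    using d[of w] min[of w] that by auto
  then show "\<exists>\<delta>>0. \<forall>w\<in>\<Omega>. norm (w - p) < \<delta> \<longrightarrow> \<xi> \<bullet> (w - p) \<le> \<epsilon> * norm (w - p)"
    using \<open>\<delta> > 0\<close> \<open>r > 0\<close> by (intro exI[of _ "min \<delta> r"]) auto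
qed

section \<open>The fuzzy intersection rule\<close>

text \<open>
  As the penalty grows, pairs \<open>(p, q)\<close> whose penalised objective is at most its value \<open>0\<close> at \<open>(z, z)\<close>
  cluster only at diagonal pairs \<open>(p, p)\<close> with \<open>p \<in> A \<inter> B\<close>. There the normality estimate gives
  \<open>(2 * \<eta> / \<delta>) * \<parallel>p - z\<parallel>\<^sup>2 \<le> \<eta> * \<parallel>p - z\<parallel>\<close>, that is \<open>\<parallel>p - z\<parallel> \<le> \<delta> / 2\<close>. For a large penalty the constraint to
  the ball of radius \<open>\<delta>\<close> is therefore inactive at a minimiser.
\<close>

lemma penalised_sublevel_interior:
  fixes A B :: "'a::euclidean_space set"
  assumes closed: "closed A" "closed B" and "\<delta> > 0" "\<eta> > 0"
    and est: "\<And>w. w \<in> A \<inter> B \<Longrightarrow> norm (w - z) \<le> \<delta> \<Longrightarrow> \<xi> \<bullet> (w - z) \<le> \<eta> * norm (w - z)"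
  shows "\<exists>n::nat. \<forall>p \<in> A \<inter> cball z \<delta>. \<forall>q \<in> B \<inter> cball z \<delta>.
    2 * \<eta> / \<delta> * (norm (p - z))\<^sup>2 + real n * (norm (p - q))\<^sup>2 \<le> \<xi> \<bullet> (p - z) \<longrightarrow>
    norm (p - z) < \<delta> \<and> norm (q - z) < \<delta>"
proof (rule ccontr)
  let ?good = "\<lambda>n p q. p \<in> A \<inter> cball z \<delta> \<and> q \<in> B \<inter> cball z \<delta> \<and>
    2 * \<eta> / \<delta> * (norm (p - z))\<^sup>2 + real n * (norm (p - q))\<^sup>2 \<le> \<xi> \<bullet> (p - z)"
  assume "\<not> ?thesis"
  then have "\<forall>n. \<exists>p q. ?good n p q \<and> \<not> (norm (p - z) < \<delta> \<and> norm (q - z) < \<delta>)"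
    by blast
  then obtain P Q where good: "\<And>n. ?good n (P n) (Q n)"
    and bad: "\<And>n. \<not> (norm (P n - z) < \<delta> \<and> norm (Q n - z) < \<delta>)"
    by metis
  have "compact ((A \<inter> cball z \<delta>) \<times> (B \<inter> cball z \<delta>))"
    using closed by (intro compact_Times closed_Int_compact) auto
  moreover have "\<forall>n. (P n, Q n) \<in> (A \<inter> cball z \<delta>) \<times> (B \<inter> cball z \<delta>)"
    using good by blast
  ultimately obtain l r where l: "l \<in> (A \<inter> cball z \<delta>) \<times> (B \<inter> cball z \<delta>)"
    and r: "strict_mono r" and lim: "((\<lambda>n. (P n, Q n)) \<circ> r) \<longlonglongrightarrow> l"
    by (rule seq_compactE[OF compact_imp_seq_compact])
  obtain p q where pq: "l = (p, q)" by (cases l)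
  have P: "(\<lambda>n. P (r n)) \<longlonglongrightarrow> p" and Q: "(\<lambda>n. Q (r n)) \<longlonglongrightarrow> q"
    using tendsto_fst[OF lim] tendsto_snd[OF lim] by (auto simp: pq o_def)
  have cost: "real n * (norm (P (r n) - Q (r n)))\<^sup>2 \<le> norm \<xi> * \<delta>" for n
  proof -
    have "real n * (norm (P (r n) - Q (r n)))\<^sup>2 \<le> real (r n) * (norm (P (r n) - Q (r n)))\<^sup>2"
      using seq_suble[OF r, of n] by (intro mult_right_mono) auto
    also have "\<dots> \<le> \<xi> \<bullet> (P (r n) - z)"
      using good[of "r n"] \<open>\<delta> > 0\<close> \<open>\<eta> > 0\<close>
      by (smt (verit) divide_nonneg_nonneg mult_nonneg_nonneg zero_le_power2)
    also have "\<dots> \<le> norm \<xi> * norm (P (r n) - z)" by (rule norm_cauchy_schwarz)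
    also have "\<dots> \<le> norm \<xi> * \<delta>"
      using good[of "r n"] by (intro mult_left_mono) (auto simp: dist_norm norm_minus_commute)
    finally show ?thesis .
  qed
  have "(norm (p - q))\<^sup>2 \<le> norm \<xi> * \<delta> * 0"
  proof (rule LIMSEQ_le)
    show "(\<lambda>n. (norm (P (r n) - Q (r n)))\<^sup>2) \<longlonglongrightarrow> (norm (p - q))\<^sup>2"
      by (intro tendsto_intros P Q)
    show "(\<lambda>n. norm \<xi> * \<delta> * inverse (real n)) \<longlonglongrightarrow> norm \<xi> * \<delta> * 0"
      by (intro tendsto_intros lim_inverse_n)
    show "\<exists>N. \<forall>n\<ge>N. (norm (P (r n) - Q (r n)))\<^sup>2 \<le> norm \<xi> * \<delta> * inverse (real n)"
      using cost by (intro exI[of _ 1]) (auto simp: field_simps)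
  qed
  then have "p = q" by simp
  have "2 * \<eta> / \<delta> * (norm (p - z))\<^sup>2 \<le> \<xi> \<bullet> (p - z)"
  proof (rule LIMSEQ_le)
    show "(\<lambda>n. 2 * \<eta> / \<delta> * (norm (P (r n) - z))\<^sup>2) \<longlonglongrightarrow> 2 * \<eta> / \<delta> * (norm (p - z))\<^sup>2"
      by (intro tendsto_intros P)
    show "(\<lambda>n. \<xi> \<bullet> (P (r n) - z)) \<longlonglongrightarrow> \<xi> \<bullet> (p - z)"
      by (intro tendsto_intros P)
    have "0 \<le> real (r n) * (norm (P (r n) - Q (r n)))\<^sup>2" for n by simp
    then show "\<exists>N. \<forall>n\<ge>N. 2 * \<eta> / \<delta> * (norm (P (r n) - z))\<^sup>2 \<le> \<xi> \<bullet> (P (r n) - z)"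
      using good by (smt (verit))
  qed
  also have "\<dots> \<le> \<eta> * norm (p - z)"
    using l est[of p] by (auto simp: pq \<open>p = q\<close> dist_norm norm_minus_commute)
  finally have "2 * norm (p - z) * norm (p - z) \<le> \<delta> * norm (p - z)"
    using \<open>\<delta> > 0\<close> \<open>\<eta> > 0\<close> by (simp add: field_simps power2_eq_square)
  then have "norm (p - z) < \<delta>"
    using \<open>\<delta> > 0\<close> by (cases "p = z") auto
  then have "\<forall>\<^sub>F n in sequentially. norm (P (r n) - z) < \<delta>"
    and "\<forall>\<^sub>F n in sequentially. norm (Q (r n) - z) < \<delta>"
    using P Q \<open>p = q\<close> by (auto intro!: order_tendstoD tendsto_intros)
  then have "\<forall>\<^sub>F n::nat in sequentially. False"
    by eventually_elim (use bad in blast)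
  then show False by simp
qed

text \<open>
  The quadratic term in \<open>p - z\<close>, smooth where the error term \<open>\<epsilon> * \<parallel>p - z\<parallel>\<close> of the regular normal is not,
  keeps a minimiser of the penalised objective away from the boundary of the ball. Its gradient
  is at most \<open>\<epsilon>\<close> there, and the gradients of the penalty in \<open>p\<close> and in \<open>q\<close> cancel.
\<close>

theorem fuzzy_intersection_rule:
  fixes A B :: "'a::euclidean_space set"
  assumes closed: "closed A" "closed B" and z: "z \<in> A \<inter> B"
    and normal: "\<xi> \<in> regular_normal_cone (A \<inter> B) z" and "\<epsilon> > 0"
  obtains p q \<alpha> \<beta> where
    "p \<in> A" "norm (p - z) \<le> \<epsilon>" "\<alpha> \<in> regular_normal_cone A p"
    "q \<in> B" "norm (q - z) \<le> \<epsilon>" "\<beta> \<in> regular_normal_cone B q"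
    "norm (\<alpha> + \<beta> - \<xi>) \<le> \<epsilon>"
proof -
  have "\<epsilon> / 4 > 0" using \<open>\<epsilon> > 0\<close> by simp
  then obtain \<delta>0 where "\<delta>0 > 0" and
    d0: "\<And>w. w \<in> A \<inter> B \<Longrightarrow> norm (w - z) < \<delta>0 \<Longrightarrow> \<xi> \<bullet> (w - z) \<le> \<epsilon> / 4 * norm (w - z)"
    using normal unfolding regular_normal_cone_iff by meson
  define \<delta> where "\<delta> = min \<epsilon> (\<delta>0 / 2)"
  have \<delta>: "\<delta> > 0" "\<delta> \<le> \<epsilon>" "\<delta> < \<delta>0" using \<open>\<delta>0 > 0\<close> \<open>\<epsilon> > 0\<close> by (auto simp: \<delta>_def)
  \<comment> \<open>The quarter of \<open>\<epsilon>\<close> makes the gradient bound \<open>2 * c * \<delta>\<close> of the quadratic term equal to \<open>\<epsilon>\<close>.\<close>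
  define c where "c = 2 * (\<epsilon> / 4) / \<delta>"
  have est: "\<xi> \<bullet> (w - z) \<le> \<epsilon> / 4 * norm (w - z)" if "w \<in> A \<inter> B" "norm (w - z) \<le> \<delta>" for w
    using d0[OF that(1)] that(2) \<delta>(3) by simp
  obtain n :: nat where n:
    "\<And>p q. p \<in> A \<inter> cball z \<delta> \<Longrightarrow> q \<in> B \<inter> cball z \<delta> \<Longrightarrow>
       c * (norm (p - z))\<^sup>2 + real n * (norm (p - q))\<^sup>2 \<le> \<xi> \<bullet> (p - z) \<Longrightarrow>
       norm (p - z) < \<delta> \<and> norm (q - z) < \<delta>"
    using penalised_sublevel_interior[OF closed \<delta>(1) \<open>\<epsilon> / 4 > 0\<close> est] unfolding c_def by blast
  define f where
    "f = (\<lambda>p q. c * ((p - z) \<bullet> (p - z)) + real n * ((p - q) \<bullet> (p - q)) - \<xi> \<bullet> (p - z))"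
  let ?K = "(A \<inter> cball z \<delta>) \<times> (B \<inter> cball z \<delta>)"
  have "compact ?K"
    using closed by (intro compact_Times closed_Int_compact) auto
  moreover have zK: "(z, z) \<in> ?K" using z \<delta>(1) by simp
  moreover have "continuous_on ?K (\<lambda>(p, q). f p q)"
    unfolding f_def case_prod_unfold by (intro continuous_intros)
  ultimately obtain m where "m \<in> ?K" "\<And>w. w \<in> ?K \<Longrightarrow> (\<lambda>(p, q). f p q) m \<le> (\<lambda>(p, q). f p q) w"
    using continuous_attains_inf[of ?K "\<lambda>(p, q). f p q"] by blast
  moreover obtain p q where "m = (p, q)" by (cases m)
  ultimately have p: "p \<in> A" "p \<in> cball z \<delta>" and q: "q \<in> B" "q \<in> cball z \<delta>"
    and min: "\<And>p' q'. p' \<in> A \<inter> cball z \<delta> \<Longrightarrow> q' \<in> B \<inter> cball z \<delta> \<Longrightarrow> f p q \<le> f p' q'"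
    by auto
  have "f p q \<le> f z z" using zK by (intro min) auto
  then have interior: "norm (p - z) < \<delta>" "norm (q - z) < \<delta>"
    using n[of p q] p q by (auto simp: f_def power2_norm_eq_inner)
  define \<beta> where "\<beta> = (2 * real n) *\<^sub>R (p - q)"
  define \<alpha> where "\<alpha> = \<xi> - (2 * c) *\<^sub>R (p - z) - \<beta>"
  show ?thesis
  proof
    show "p \<in> A" "q \<in> B" "norm (p - z) \<le> \<epsilon>" "norm (q - z) \<le> \<epsilon>"
      using p q interior \<delta>(2) by auto
    show "\<alpha> \<in> regular_normal_cone A p"
    proof (rule regular_normal_cone_local_min)
      show "((\<lambda>p. f p q) has_derivative (\<lambda>d. - (\<alpha> \<bullet> d))) (at p)"
        unfolding f_def \<alpha>_def \<beta>_def
        by (auto intro!: derivative_eq_intros ext simp: inner_diff_left inner_commute algebra_simps)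
      show "\<delta> - norm (p - z) > 0" using interior by simp
      fix w assume "w \<in> A" "norm (w - p) < \<delta> - norm (p - z)"
      then show "f p q \<le> f w q"
        using q norm_triangle_ineq[of "w - p" "p - z"]
        by (intro min) (auto simp: dist_norm norm_minus_commute)
    qed
    show "\<beta> \<in> regular_normal_cone B q"
    proof (rule regular_normal_cone_local_min)
      show "((\<lambda>q. f p q) has_derivative (\<lambda>d. - (\<beta> \<bullet> d))) (at q)"
        unfolding f_def \<beta>_def
        by (auto intro!: derivative_eq_intros ext simp: inner_diff_left inner_commute algebra_simps)
      show "\<delta> - norm (q - z) > 0" using interior by simp
      fix w assume "w \<in> B" "norm (w - q) < \<delta> - norm (q - z)"
      then show "f p q \<le> f p w"
        using p norm_triangle_ineq[of "w - q" "q - z"]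
        by (intro min) (auto simp: dist_norm norm_minus_commute)
    qed
    have "c \<ge> 0" using \<delta>(1) \<open>\<epsilon> > 0\<close> by (simp add: c_def)
    then have "norm (\<alpha> + \<beta> - \<xi>) \<le> 2 * c * \<delta>"
      using interior by (auto simp: \<alpha>_def intro!: mult_left_mono)
    also have "\<dots> = \<epsilon>" using \<delta>(1) by (simp add: c_def)
    finally show "norm (\<alpha> + \<beta> - \<xi>) \<le> \<epsilon>" .
  qed
qed

section \<open>Regular normals to the graph of a sum\<close>

text \<open>
  The triples \<open>(x, a, b)\<close> with \<open>a \<in> F1 x\<close> and \<open>b \<in> F2 x\<close> form the intersection of a cylinder over each
  graph, and addition of \<open>a\<close> and \<open>b\<close> maps it into the graph of the sum. A normal to a cylinder vanishes in the
  free direction, so each of the value components \<open>- v, - v\<close> is carried by only one of the pieces.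
\<close>

theorem regular_normal_cone_gph_sum:
  fixes F1 F2 :: "'a::euclidean_space \<Rightarrow> 'b::euclidean_space set"
  assumes closed: "closed (gph F1)" "closed (gph F2)"
    and mem: "a \<in> F1 x" "b \<in> F2 x"
    and normal: "(u, - v) \<in> regular_normal_cone (gph (\<lambda>x. F1 x + F2 x)) (x, a + b)"
    and "\<epsilon> > 0"
  obtains x1 a' u1 v1 x2 b' u2 v2 where
    "(x1, a') \<in> gph F1" "norm (x1 - x) \<le> \<epsilon>" "norm (a' - a) \<le> \<epsilon>"
    "(u1, - v1) \<in> regular_normal_cone (gph F1) (x1, a')"
    "(x2, b') \<in> gph F2" "norm (x2 - x) \<le> \<epsilon>" "norm (b' - b) \<le> \<epsilon>"
    "(u2, - v2) \<in> regular_normal_cone (gph F2) (x2, b')"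
    "norm (u1 + u2 - u) \<le> \<epsilon>" "norm (v1 - v) \<le> \<epsilon>" "norm (v2 - v) \<le> \<epsilon>"
proof -
  define A where "A = (\<lambda>w::'a \<times> 'b \<times> 'b. (fst w, fst (snd w))) -` gph F1"
  define B where "B = (\<lambda>w::'a \<times> 'b \<times> 'b. (fst w, snd (snd w))) -` gph F2"
  have closedAB: "closed A" "closed B"
    unfolding A_def B_def by (intro continuous_closed_vimage closed; simp add: continuous_intros)+
  have "(x, a, b) \<in> A \<inter> B" using mem by (simp add: A_def B_def gph_def)
  moreover have "(u, - v, - v) \<in> regular_normal_cone (A \<inter> B) (x, a, b)"
    by (rule regular_normal_cone_pullback[where h = "\<lambda>w. (fst w, fst (snd w) + snd (snd w))"
          and L = "\<lambda>w. (fst w, fst (snd w) + snd (snd w))" and \<xi> = "(u, - v)"])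
      (use normal in \<open>auto simp: A_def B_def gph_def inner_add_right linear_conv_bounded_linear[symmetric] linear_iff scaleR_add_right\<close>)
  ultimately obtain p q \<alpha> \<beta> where
    p: "p \<in> A" "norm (p - (x, a, b)) \<le> \<epsilon>" "\<alpha> \<in> regular_normal_cone A p" and
    q: "q \<in> B" "norm (q - (x, a, b)) \<le> \<epsilon>" "\<beta> \<in> regular_normal_cone B q" and
    sum: "norm (\<alpha> + \<beta> - (u, - v, - v)) \<le> \<epsilon>"
    using \<open>\<epsilon> > 0\<close> by (rule fuzzy_intersection_rule[OF closedAB])
  obtain x1 a' b'' where p_eq: "p = (x1, a', b'')" by (cases p)
  obtain x2 a'' b' where q_eq: "q = (x2, a'', b')" by (cases q)
  obtain u1 v1 w1 where \<alpha>_eq: "\<alpha> = (u1, - v1, w1)"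
    by (cases \<alpha>) (metis minus_minus)
  obtain u2 w2 v2 where \<beta>_eq: "\<beta> = (u2, w2, - v2)"
    by (cases \<beta>) (metis minus_minus)
  have comp: "norm c1 \<le> \<epsilon> \<and> norm c2 \<le> \<epsilon> \<and> norm c3 \<le> \<epsilon>" if "norm (c1, c2, c3) \<le> \<epsilon>"
    for c1 :: 'a and c2 c3 :: 'b
    using that norm_fst_le[of c1 "(c2, c3)"] norm_snd_le[of "(c2, c3)" c1]
      norm_fst_le[of c2 c3] norm_snd_le[of c3 c2] by linarith
  have "w1 \<in> regular_normal_cone UNIV b''"
    by (rule regular_normal_cone_pullback[where h = "\<lambda>c. (x1, a', c)" and L = "\<lambda>c. (0, 0, c)"
          and \<xi> = \<alpha> and \<Omega> = A])
      (use p in \<open>auto simp: p_eq \<alpha>_eq A_def linear_conv_bounded_linear[symmetric] linear_iff scaleR_add_right\<close>)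
  then have w1: "w1 = 0" by (rule regular_normal_cone_UNIV)
  have "w2 \<in> regular_normal_cone UNIV a''"
    by (rule regular_normal_cone_pullback[where h = "\<lambda>c. (x2, c, b')" and L = "\<lambda>c. (0, c, 0)"
          and \<xi> = \<beta> and \<Omega> = B])
      (use q in \<open>auto simp: q_eq \<beta>_eq B_def linear_conv_bounded_linear[symmetric] linear_iff scaleR_add_right\<close>)
  then have w2: "w2 = 0" by (rule regular_normal_cone_UNIV)
  show ?thesis
  proof
    show "(x1, a') \<in> gph F1" "(x2, b') \<in> gph F2"
      using p(1) q(1) by (auto simp: p_eq q_eq A_def B_def)
    show "norm (x1 - x) \<le> \<epsilon>" "norm (a' - a) \<le> \<epsilon>" "norm (x2 - x) \<le> \<epsilon>" "norm (b' - b) \<le> \<epsilon>"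
      using comp[of "x1 - x" "a' - a" "b'' - b"] comp[of "x2 - x" "a'' - a" "b' - b"] p(2) q(2)
      by (auto simp: p_eq q_eq)
    show "norm (u1 + u2 - u) \<le> \<epsilon>" "norm (v1 - v) \<le> \<epsilon>" "norm (v2 - v) \<le> \<epsilon>"
      using comp[of "u1 + u2 - u" "v - v1" "v - v2"] sum
      by (auto simp: \<alpha>_eq \<beta>_eq w1 w2 norm_minus_commute)
    show "(u1, - v1) \<in> regular_normal_cone (gph F1) (x1, a')"
      by (rule regular_normal_cone_pullback[where h = "\<lambda>w. (fst w, snd w, b'')"
            and L = "\<lambda>w. (fst w, snd w, 0)" and \<xi> = \<alpha> and \<Omega> = A])
        (use p in \<open>auto simp: p_eq \<alpha>_eq A_def linear_conv_bounded_linear[symmetric] linear_iff scaleR_add_right\<close>)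
    show "(u2, - v2) \<in> regular_normal_cone (gph F2) (x2, b')"
      by (rule regular_normal_cone_pullback[where h = "\<lambda>w. (fst w, a'', snd w)"
            and L = "\<lambda>w. (fst w, 0, snd w)" and \<xi> = \<beta> and \<Omega> = B])
        (use q in \<open>auto simp: q_eq \<beta>_eq B_def linear_conv_bounded_linear[symmetric] linear_iff scaleR_add_right\<close>)
  qed
qed

section \<open>Passing to infinity\<close>

text \<open>
  The scaling factors \<open>c k\<close> allow normals that are themselves unbounded.
\<close>

lemma normal_cone_at_infinityI:
  assumes "\<And>k::nat. (x k, y' k) \<in> \<Omega>" "\<And>k. \<xi>' k \<in> regular_normal_cone \<Omega> (x k, y' k)"
    and "\<And>k. c k > 0" "filterlim (\<lambda>k. norm (x k)) at_top sequentially" "y' \<longlonglongrightarrow> y"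
    and "(\<lambda>k. c k *\<^sub>R \<xi>' k) \<longlonglongrightarrow> \<xi>"
  shows "\<xi> \<in> normal_cone_at_infinity \<Omega> y"
  unfolding normal_cone_at_infinity_def mem_Collect_eq
  by (rule exI[of _ x], rule exI[of _ y'], rule exI[of _ "\<lambda>k. c k *\<^sub>R \<xi>' k"])
    (use assms in \<open>auto intro: regular_normal_cone_scaleR\<close>)

lemma normal_cone_at_infinity_scaleR:
  assumes "\<xi> \<in> normal_cone_at_infinity \<Omega> y" "c > 0"
  shows "c *\<^sub>R \<xi> \<in> normal_cone_at_infinity \<Omega> y"
proof -
  obtain X Y \<Xi> where "\<And>k::nat. (X k, Y k) \<in> \<Omega>" "\<And>k. \<Xi> k \<in> regular_normal_cone \<Omega> (X k, Y k)"
    "filterlim (\<lambda>k. norm (X k)) at_top sequentially" "Y \<longlonglongrightarrow> y" "\<Xi> \<longlonglongrightarrow> \<xi>"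
    using assms(1) unfolding normal_cone_at_infinity_def by blast
  then show ?thesis
    using \<open>c > 0\<close> by (intro normal_cone_at_infinityI[where c = "\<lambda>_. c"] tendsto_scaleR tendsto_const)
qed

lemma bounded_pair_cluster:
  fixes a b :: "nat \<Rightarrow> 'a::euclidean_space"
  assumes "\<forall>\<^sub>F k in sequentially. norm (a k) < \<rho> \<and> norm (b k) < \<rho>"
  obtains r a' b' where "strict_mono r" "(\<lambda>k. a (r k)) \<longlonglongrightarrow> a'" "(\<lambda>k. b (r k)) \<longlonglongrightarrow> b'"
proof -
  have "\<forall>\<^sub>F k in sequentially. norm (a k, b k) \<le> \<rho> + \<rho>"
    using assms by eventually_elim (use norm_Pair_le in \<open>smt (verit)\<close>)
  then have "bounded (range (\<lambda>k. (a k, b k)))"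
    unfolding Bseq_eq_bounded[symmetric] by (rule BfunI)
  then obtain l r where r: "strict_mono r" and lim: "((\<lambda>k. (a k, b k)) \<circ> r) \<longlonglongrightarrow> l"
    using bounded_imp_convergent_subsequence by blast
  show ?thesis
    using that[OF r] tendsto_fst[OF lim] tendsto_snd[OF lim] by (simp add: o_def)
qed

lemma tendsto_vanishing_perturbation:
  fixes f g :: "nat \<Rightarrow> 'a::real_normed_vector"
  assumes "f \<longlonglongrightarrow> l" "\<And>k. norm (g k - f k) \<le> inverse (real (Suc k))"
  shows "g \<longlonglongrightarrow> l"
proof -
  have "(\<lambda>k. g k - f k) \<longlonglongrightarrow> 0"
    by (rule Lim_null_comparison[OF _ LIMSEQ_inverse_real_of_nat]) (use assms(2) in auto)
  then show ?thesis using Lim_transform[OF assms(1)] by simp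
qed

lemma norm_at_top_perturbation:
  fixes x x' :: "nat \<Rightarrow> 'a::real_normed_vector"
  assumes "filterlim (\<lambda>k. norm (x k)) at_top sequentially"
    and "\<And>k. norm (x' k - x k) \<le> inverse (real (Suc k))"
  shows "filterlim (\<lambda>k. norm (x' k)) at_top sequentially"
proof (rule filterlim_at_top_mono)
  show "filterlim (\<lambda>k. - 1 + norm (x k)) at_top sequentially"
    using filterlim_tendsto_add_at_top[OF tendsto_const assms(1)] .
  have "- 1 + norm (x k) \<le> norm (x' k)" for k
  proof -
    have "inverse (real (Suc k)) \<le> 1" by (simp add: field_simps)
    then show ?thesis
      using assms(2)[of k] norm_triangle_ineq3[of "x' k" "x k"] by linarith
  qed
  then show "\<forall>\<^sub>F k in sequentially. - 1 + norm (x k) \<le> norm (x' k)" by simp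
qed

lemma filterlim_norm_subseq:
  fixes x :: "nat \<Rightarrow> 'a::real_normed_vector"
  assumes "filterlim (\<lambda>k. norm (x k)) at_top sequentially" "strict_mono r"
  shows "filterlim (\<lambda>k. norm (x (r k))) at_top sequentially"
  using filterlim_compose[OF assms(1) filterlim_subseq[OF assms(2)]] .

text \<open>
  A sum of closed-graph mappings can fail to be closed only if the summands escape to infinity while their sum
  converges; the bound excludes this over \<open>norm x > R\<close>.
\<close>

lemma locally_closed_at_infinity_gph_sum:
  fixes F1 F2 :: "'a::euclidean_space \<Rightarrow> 'b::euclidean_space set"
  assumes closed: "closed (gph F1)" "closed (gph F2)"
    and "R > 0" "y \<in> interior V"
    and bound: "\<And>x a b. norm x > R \<Longrightarrow> a \<in> F1 x \<Longrightarrow> b \<in> F2 x \<Longrightarrow> a + b \<in> V \<Longrightarrow>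
      norm a < \<rho> \<and> norm b < \<rho>"
  shows "locally_closed_at_infinity (gph (\<lambda>x. F1 x + F2 x)) y"
proof -
  obtain d where "d > 0" and d: "cball y d \<subseteq> V"
    using \<open>y \<in> interior V\<close> mem_interior_cball by blast
  let ?S = "{(x, y'). (x, y') \<in> gph (\<lambda>x. F1 x + F2 x) \<and> R + 1 \<le> norm x \<and> y' \<in> cball y d}"
  have "closed ?S"
    unfolding closed_sequential_limits
  proof (intro allI impI, elim conjE)
    fix w l assume w: "\<forall>k::nat. w k \<in> ?S" and lim: "w \<longlonglongrightarrow> l"
    define x y' where "x = fst \<circ> w" and "y' = snd \<circ> w"
    have x: "x \<longlonglongrightarrow> fst l" and y': "y' \<longlonglongrightarrow> snd l"
      using lim by (auto simp: x_def y'_def o_def intro: tendsto_intros)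
    have far: "R + 1 \<le> norm (x k)" and near: "y' k \<in> cball y d" for k
      using w by (auto simp: x_def y'_def case_prod_unfold)
    have "\<forall>k. \<exists>a b. y' k = a + b \<and> a \<in> F1 (x k) \<and> b \<in> F2 (x k)"
      using w by (fastforce simp: x_def y'_def case_prod_unfold gph_def elim: set_plus_elim)
    then obtain a b where ab: "\<And>k. y' k = a k + b k" "\<And>k. a k \<in> F1 (x k)" "\<And>k. b k \<in> F2 (x k)"
      by metis
    have "norm (a k) < \<rho> \<and> norm (b k) < \<rho>" for k
      using bound[of "x k" "a k" "b k"] ab[of k] far[of k] near[of k] d by auto
    then have "\<forall>\<^sub>F k in sequentially. norm (a k) < \<rho> \<and> norm (b k) < \<rho>"
      by simp
    then obtain r a' b' where r: "strict_mono r"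
      and a': "(\<lambda>k. a (r k)) \<longlonglongrightarrow> a'" and b': "(\<lambda>k. b (r k)) \<longlonglongrightarrow> b'"
      by (rule bounded_pair_cluster)
    have xr: "(\<lambda>k. x (r k)) \<longlonglongrightarrow> fst l" and yr: "(\<lambda>k. y' (r k)) \<longlonglongrightarrow> snd l"
      using LIMSEQ_subseq_LIMSEQ[OF x r] LIMSEQ_subseq_LIMSEQ[OF y' r] by (auto simp: o_def)
    have "(fst l, a') \<in> gph F1" "(fst l, b') \<in> gph F2"
      by (rule closed_sequentially[OF closed(1) _ tendsto_Pair[OF xr a']],
          use ab in \<open>simp add: gph_def\<close>,
          rule closed_sequentially[OF closed(2) _ tendsto_Pair[OF xr b']],
          use ab in \<open>simp add: gph_def\<close>)
    moreover have "snd l = a' + b'"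
      using LIMSEQ_unique[OF yr] tendsto_add[OF a' b'] by (simp add: ab(1))
    moreover have "R + 1 \<le> norm (fst l)"
      using LIMSEQ_le_const[OF tendsto_norm[OF x]] far by blast
    moreover have "snd l \<in> cball y d"
      using closed_sequentially[OF closed_cball _ y'] near by blast
    ultimately show "l \<in> ?S"
      by (auto simp: gph_def case_prod_unfold)
  qed
  moreover have "y \<in> interior (cball y d)" using \<open>d > 0\<close> by simp
  ultimately show ?thesis
    unfolding locally_closed_at_infinity_def using \<open>R > 0\<close>
    \<comment> \<open>The bound holds for \<open>norm x > R\<close>, the required region is \<open>norm x \<ge> R'\<close>: any \<open>R' > R\<close> serves.\<close>
    by (intro exI[of _ "R + 1"] conjI exI[of _ "cball y d"]) auto
qed

text \<open>
  The qualification acts as a boundedness criterion: if the pieces \<open>u1 k\<close> and \<open>u2 k\<close> of the split normals grew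
  without bound while their sum converged, their common direction would lie in both singular coderivatives
  with opposite signs.
\<close>

lemma coderivative_at_infinity_sum:
  fixes F1 F2 :: "'a::euclidean_space \<Rightarrow> 'b::euclidean_space set"
  assumes closed: "closed (gph F1)" "closed (gph F2)"
    and "y \<in> interior V"
    and bound: "\<And>x a b. norm x > R \<Longrightarrow> a \<in> F1 x \<Longrightarrow> b \<in> F2 x \<Longrightarrow> a + b \<in> V \<Longrightarrow>
      norm a < \<rho> \<and> norm b < \<rho>"
    and qualification: "\<And>a b u. (a, b) \<in> jelonek_plus F1 F2 y \<Longrightarrow>
      u \<in> coderivative_at_infinity F1 a 0 \<Longrightarrow> - u \<in> coderivative_at_infinity F2 b 0 \<Longrightarrow> u = 0"
  shows "coderivative_at_infinity (\<lambda>x. F1 x + F2 x) y v \<subseteq>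
    (\<Union>(a, b) \<in> jelonek_plus F1 F2 y.
       coderivative_at_infinity F1 a v + coderivative_at_infinity F2 b v)"
proof
  fix u assume u: "u \<in> coderivative_at_infinity (\<lambda>x. F1 x + F2 x) y v"
  let ?G = "gph (\<lambda>x. F1 x + F2 x)"
  obtain x y' \<Xi> where
    seq: "\<And>k::nat. (x k, y' k) \<in> ?G" "\<And>k. \<Xi> k \<in> regular_normal_cone ?G (x k, y' k)"
    and x: "filterlim (\<lambda>k. norm (x k)) at_top sequentially"
    and y': "y' \<longlonglongrightarrow> y" and \<Xi>: "\<Xi> \<longlonglongrightarrow> (u, - v)"
    using u unfolding coderivative_at_infinity_def normal_cone_at_infinity_def by blast
  define U W where "U = (\<lambda>k. fst (\<Xi> k))" and "W = (\<lambda>k. - snd (\<Xi> k))"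
  have \<Xi>_eq: "\<Xi> k = (U k, - W k)" for k by (simp add: U_def W_def)
  have U: "U \<longlonglongrightarrow> u" and W: "W \<longlonglongrightarrow> v"
    using tendsto_fst[OF \<Xi>] tendsto_minus[OF tendsto_snd[OF \<Xi>]] by (auto simp: U_def W_def)
  have "\<forall>k. \<exists>a b. y' k = a + b \<and> a \<in> F1 (x k) \<and> b \<in> F2 (x k)"
    using seq(1) by (fastforce simp: gph_def elim: set_plus_elim)
  then obtain a b where ab: "\<And>k. y' k = a k + b k" "\<And>k. a k \<in> F1 (x k)" "\<And>k. b k \<in> F2 (x k)"
    by metis
  have "\<forall>\<^sub>F k in sequentially. R < norm (x k)"
    using x by (simp add: filterlim_at_top_dense)
  moreover have "\<forall>\<^sub>F k in sequentially. y' k \<in> interior V"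
    using topological_tendstoD[OF y' open_interior \<open>y \<in> interior V\<close>] .
  ultimately have "\<forall>\<^sub>F k in sequentially. norm (a k) < \<rho> \<and> norm (b k) < \<rho>"
    by eventually_elim (use bound ab interior_subset in \<open>metis subsetD\<close>)
  then obtain r a' b' where r: "strict_mono r"
    and a': "(\<lambda>k. a (r k)) \<longlonglongrightarrow> a'" and b': "(\<lambda>k. b (r k)) \<longlonglongrightarrow> b'"
    by (rule bounded_pair_cluster)
  have xr: "filterlim (\<lambda>k. norm (x (r k))) at_top sequentially"
    by (rule filterlim_norm_subseq[OF x r])
  have "a' + b' = y"
    using LIMSEQ_unique[OF LIMSEQ_subseq_LIMSEQ[OF y' r]] tendsto_add[OF a' b']
    by (simp add: ab(1) o_def)
  then have J: "(a', b') \<in> jelonek_plus F1 F2 y"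
    unfolding jelonek_plus_def mem_Collect_eq case_prod_conv
    by (intro conjI exI[of _ "\<lambda>k. x (r k)"] exI[of _ "\<lambda>k. a (r k)"] exI[of _ "\<lambda>k. b (r k)"])
      (use xr ab a' b' in \<open>auto intro: tendsto_Pair\<close>)
  have "\<exists>x1 a1 u1 v1 x2 b2 u2 v2.
    (x1, a1) \<in> gph F1 \<and> norm (x1 - x (r k)) \<le> inverse (Suc k) \<and> norm (a1 - a (r k)) \<le> inverse (Suc k) \<and>
    (u1, - v1) \<in> regular_normal_cone (gph F1) (x1, a1) \<and>
    (x2, b2) \<in> gph F2 \<and> norm (x2 - x (r k)) \<le> inverse (Suc k) \<and> norm (b2 - b (r k)) \<le> inverse (Suc k) \<and>
    (u2, - v2) \<in> regular_normal_cone (gph F2) (x2, b2) \<and>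
    norm (u1 + u2 - U (r k)) \<le> inverse (Suc k) \<and>
    norm (v1 - W (r k)) \<le> inverse (Suc k) \<and> norm (v2 - W (r k)) \<le> inverse (Suc k)" for k
  proof -
    have "(U (r k), - W (r k)) \<in> regular_normal_cone ?G (x (r k), a (r k) + b (r k))"
      using seq(2)[of "r k"] by (simp add: \<Xi>_eq ab(1))
    then show ?thesis
      by (rule regular_normal_cone_gph_sum[OF closed ab(2,3), where \<epsilon> = "inverse (Suc k)"]) (simp, blast)
  qed
  then obtain x1 a1 u1 v1 x2 b2 u2 v2 where
    g1: "\<And>k. (x1 k, a1 k) \<in> gph F1" and
    x1: "\<And>k. norm (x1 k - x (r k)) \<le> inverse (Suc k)" and
    a1: "\<And>k. norm (a1 k - a (r k)) \<le> inverse (Suc k)" and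
    n1: "\<And>k. (u1 k, - v1 k) \<in> regular_normal_cone (gph F1) (x1 k, a1 k)" and
    g2: "\<And>k. (x2 k, b2 k) \<in> gph F2" and
    x2: "\<And>k. norm (x2 k - x (r k)) \<le> inverse (Suc k)" and
    b2: "\<And>k. norm (b2 k - b (r k)) \<le> inverse (Suc k)" and
    n2: "\<And>k. (u2 k, - v2 k) \<in> regular_normal_cone (gph F2) (x2 k, b2 k)" and
    u12: "\<And>k. norm (u1 k + u2 k - U (r k)) \<le> inverse (Suc k)" and
    v1: "\<And>k. norm (v1 k - W (r k)) \<le> inverse (Suc k)" and
    v2: "\<And>k. norm (v2 k - W (r k)) \<le> inverse (Suc k)"
    by metis
  have x1: "filterlim (\<lambda>k. norm (x1 k)) at_top sequentially"
    and x2: "filterlim (\<lambda>k. norm (x2 k)) at_top sequentially"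
    using norm_at_top_perturbation[OF xr x1] norm_at_top_perturbation[OF xr x2] by simp_all
  have a1: "a1 \<longlonglongrightarrow> a'" and b2: "b2 \<longlonglongrightarrow> b'"
    using tendsto_vanishing_perturbation[OF a' a1] tendsto_vanishing_perturbation[OF b' b2]
    by simp_all
  have Ur: "(\<lambda>k. U (r k)) \<longlonglongrightarrow> u" and Wr: "(\<lambda>k. W (r k)) \<longlonglongrightarrow> v"
    using LIMSEQ_subseq_LIMSEQ[OF U r] LIMSEQ_subseq_LIMSEQ[OF W r] by (auto simp: o_def)
  have v1: "v1 \<longlonglongrightarrow> v" and v2: "v2 \<longlonglongrightarrow> v" and u12: "(\<lambda>k. u1 k + u2 k) \<longlonglongrightarrow> u"
    using tendsto_vanishing_perturbation[OF Wr v1] tendsto_vanishing_perturbation[OF Wr v2]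
      tendsto_vanishing_perturbation[OF Ur u12] by simp_all
  \<comment> \<open>One normalisation serves bounded and unbounded \<open>u1\<close>: the limit \<open>\<sigma>\<close> of \<open>s\<close> vanishes exactly when
    \<open>u1\<close> diverges along the subsequence.\<close>
  define s where "s = (\<lambda>k. inverse (1 + norm (u1 k)))"
  have s: "s k > 0" "s k + norm (s k *\<^sub>R u1 k) = 1" for k
    by (simp_all add: s_def field_simps add_pos_nonneg add_nonneg_eq_0_iff)
  have "norm (s k, s k *\<^sub>R u1 k) \<le> 1" for k
    using norm_Pair_le[of "s k" "s k *\<^sub>R u1 k"] s[of k] by simp
  then have "bounded (range (\<lambda>k. (s k, s k *\<^sub>R u1 k)))"
    by (intro boundedI[where B = 1]) auto
  then obtain l q where q: "strict_mono q" and lim: "((\<lambda>k. (s k, s k *\<^sub>R u1 k)) \<circ> q) \<longlonglongrightarrow> l"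
    using bounded_imp_convergent_subsequence by blast
  define \<sigma> w where "\<sigma> = fst l" and "w = snd l"
  have \<sigma>: "(\<lambda>k. s (q k)) \<longlonglongrightarrow> \<sigma>" and w: "(\<lambda>k. s (q k) *\<^sub>R u1 (q k)) \<longlonglongrightarrow> w"
    using tendsto_fst[OF lim] tendsto_snd[OF lim] by (auto simp: \<sigma>_def w_def o_def)
  have "(\<lambda>k. s (q k) + norm (s (q k) *\<^sub>R u1 (q k))) \<longlonglongrightarrow> \<sigma> + norm w"
    by (intro tendsto_intros \<sigma> w)
  then have \<sigma>w: "\<sigma> + norm w = 1"
    unfolding s(2) using LIMSEQ_unique tendsto_const by blast
  have "\<sigma> \<ge> 0"
    using LIMSEQ_le_const[OF \<sigma>, of 0] s(1) by (meson less_imp_le)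
  have vq: "(\<lambda>k. v1 (q k)) \<longlonglongrightarrow> v" "(\<lambda>k. v2 (q k)) \<longlonglongrightarrow> v" "(\<lambda>k. u1 (q k) + u2 (q k)) \<longlonglongrightarrow> u"
    using LIMSEQ_subseq_LIMSEQ[OF v1 q] LIMSEQ_subseq_LIMSEQ[OF v2 q] LIMSEQ_subseq_LIMSEQ[OF u12 q]
    by (simp_all add: o_def)
  have N1: "(w, - (\<sigma> *\<^sub>R v)) \<in> normal_cone_at_infinity (gph F1) a'"
  proof (rule normal_cone_at_infinityI)
    show "(\<lambda>k. s (q k) *\<^sub>R (u1 (q k), - v1 (q k))) \<longlonglongrightarrow> (w, - (\<sigma> *\<^sub>R v))"
      using tendsto_Pair[OF w tendsto_minus[OF tendsto_scaleR[OF \<sigma> vq(1)]]] by simp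
  qed (use g1 n1 s(1) filterlim_norm_subseq[OF x1 q] LIMSEQ_subseq_LIMSEQ[OF a1 q] in \<open>auto simp: o_def\<close>)
  have N2: "(\<sigma> *\<^sub>R u - w, - (\<sigma> *\<^sub>R v)) \<in> normal_cone_at_infinity (gph F2) b'"
  proof (rule normal_cone_at_infinityI)
    have "(\<lambda>k. s (q k) *\<^sub>R u2 (q k)) \<longlonglongrightarrow> \<sigma> *\<^sub>R u - w"
      using tendsto_diff[OF tendsto_scaleR[OF \<sigma> vq(3)] w] by (simp add: scaleR_add_right)
    then show "(\<lambda>k. s (q k) *\<^sub>R (u2 (q k), - v2 (q k))) \<longlonglongrightarrow> (\<sigma> *\<^sub>R u - w, - (\<sigma> *\<^sub>R v))"
      using tendsto_Pair[OF _ tendsto_minus[OF tendsto_scaleR[OF \<sigma> vq(2)]]] by simp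
  qed (use g2 n2 s(1) filterlim_norm_subseq[OF x2 q] LIMSEQ_subseq_LIMSEQ[OF b2 q] in \<open>auto simp: o_def\<close>)
  have "\<sigma> \<noteq> 0"
  proof
    assume "\<sigma> = 0"
    then have "w \<in> coderivative_at_infinity F1 a' 0" "- w \<in> coderivative_at_infinity F2 b' 0"
      using N1 N2 by (simp_all add: coderivative_at_infinity_def)
    then have "w = 0" using qualification[OF J] by blast
    then show False using \<sigma>w \<open>\<sigma> = 0\<close> by simp
  qed
  then have "inverse \<sigma> > 0" using \<open>\<sigma> \<ge> 0\<close> by simp
  have "inverse \<sigma> *\<^sub>R w \<in> coderivative_at_infinity F1 a' v"
    using normal_cone_at_infinity_scaleR[OF N1 \<open>inverse \<sigma> > 0\<close>] \<open>\<sigma> \<noteq> 0\<close>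
    by (simp add: coderivative_at_infinity_def)
  moreover have "u - inverse \<sigma> *\<^sub>R w \<in> coderivative_at_infinity F2 b' v"
    using normal_cone_at_infinity_scaleR[OF N2 \<open>inverse \<sigma> > 0\<close>] \<open>\<sigma> \<noteq> 0\<close>
    by (simp add: coderivative_at_infinity_def scaleR_diff_right)
  ultimately have "inverse \<sigma> *\<^sub>R w + (u - inverse \<sigma> *\<^sub>R w)
      \<in> coderivative_at_infinity F1 a' v + coderivative_at_infinity F2 b' v"
    by (rule set_plus_intro)
  with J show "u \<in> (\<Union>(a, b) \<in> jelonek_plus F1 F2 y.
      coderivative_at_infinity F1 a v + coderivative_at_infinity F2 b v)"
    by (intro UN_I[of "(a', b')"]) auto
qed

theorem theorem3p8:
  fixes F1 F2 F :: "real ^ 'n \<Rightarrow> (real ^ 'm) set"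
    and y :: "real ^ 'm"
  assumes closed_F1: "closed (gph F1)"
    and closed_F2: "closed (gph F2)"
    and F_eq: "F = (\<lambda>x. F1 x + F2 x)"
    and y_J: "y \<in> jelonek_set F"
    and boundedness: "\<exists>R>0. \<exists>\<rho>>0. \<exists>V. y \<in> interior V \<and>
      (\<forall>x y1 y2. norm x > R \<longrightarrow> y1 \<in> F1 x \<longrightarrow> y2 \<in> F2 x \<longrightarrow> y1 + y2 \<in> V \<longrightarrow>
         norm y1 < \<rho> \<and> norm y2 < \<rho>)"
    and qualification: "\<forall>(y1, y2) \<in> jelonek_plus F1 F2 y.
      coderivative_at_infinity F1 y1 0 \<inter> uminus ` coderivative_at_infinity F2 y2 0 = {0}"
  shows "locally_closed_at_infinity (gph F) y \<and>
    (\<forall>v. coderivative_at_infinity F y v \<subseteq>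
      (\<Union>(y1, y2) \<in> jelonek_plus F1 F2 y.
         coderivative_at_infinity F1 y1 v + coderivative_at_infinity F2 y2 v))"
proof -
  obtain R \<rho> V where "R > 0" and V: "y \<in> interior V"
    and bound: "\<And>x a b. norm x > R \<Longrightarrow> a \<in> F1 x \<Longrightarrow> b \<in> F2 x \<Longrightarrow> a + b \<in> V \<Longrightarrow>
      norm a < \<rho> \<and> norm b < \<rho>"
    using boundedness by blast
  have cq: "u = 0" if "(a, b) \<in> jelonek_plus F1 F2 y"
    "u \<in> coderivative_at_infinity F1 a 0" "- u \<in> coderivative_at_infinity F2 b 0" for a b u
  proof -
    have "u \<in> uminus ` coderivative_at_infinity F2 b 0"
      using that(3) by (rule image_eqI[rotated]) simp
    then show ?thesis using bspec[OF qualification that(1)] that(2) by auto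
  qed
  show ?thesis
    unfolding F_eq
  proof (intro conjI allI)
    show "locally_closed_at_infinity (gph (\<lambda>x. F1 x + F2 x)) y"
      by (rule locally_closed_at_infinity_gph_sum[OF closed_F1 closed_F2 \<open>R > 0\<close> V]) (fact bound)
    show "coderivative_at_infinity (\<lambda>x. F1 x + F2 x) y v \<subseteq>
      (\<Union>(y1, y2) \<in> jelonek_plus F1 F2 y.
         coderivative_at_infinity F1 y1 v + coderivative_at_infinity F2 y2 v)" for v
      by (rule coderivative_at_infinity_sum[OF closed_F1 closed_F2 V]) (fact bound, fact cq)
  qed
qed

end
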